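(* Let $a,b\in\mathbb{R}$ with $a^2>b^2$, let $\omega=\sqrt{a^2-b^2}$, and let $$G(t,s)=\Big[\cos(\omega(s-t))+\frac b\omega\sin(\omega(s-t))\Big]\chi_0^t(s)+\frac a\omega\sin(\omega(s+t))\,\chi_{-t}^0(s),\qquad t,s\in\mathbb{R},$$ be the Green's function of the problem $x'(t)+a\,x(-t)+b\,x(t)=h(t)$, $x(t_0)=c$. For real $\alpha,\beta$ with $\alpha^2>\beta^2$ define $$\eta(\alpha,\beta):=\begin{cases}\frac1{\sqrt{\alpha^2-\beta^2}}\arctan\frac{\sqrt{\alpha^2-\beta^2}}{\beta}, & \beta>0,\\[2pt] \frac{\pi}{2|\alpha|}, & \beta=0,\\[2pt] \frac1{\sqrt{\alpha^2-\beta^2}}\Big(\arctan\frac{\sqrt{\alpha^2-\beta^2}}{\beta}+\pi\Big), & \beta<0.\end{cases}$$ Then: (i) if $a>0$, $G$ is positive on $[0,\eta(a,b)]\times\mathbb{R}$, i.e. for every $t\in[0,\eta(a,b)]$, $G(t,s)\ge0$ for a.e. $s\in\mathbb{R}$; (ii) if $a<0$, $G$ is negative on $[-\eta(a,-b),0]\times\mathbb{R}$, i.e. for every $t\in[-\eta(a,-b),0]$, $G(t,s)\le0$ for a.e. $s\in\mathbb{R}$; (iii) $G$ changes sign (takes both strictly positive and strictly negative values) on every other strip which is not a subset of the previous ones: on $J\times\mathbb{R}$ for every interval $J\subset\mathbb{R}$ with $J\not\subset[0,\eta(a,b)]$ if $a>0$, and for every interval $J\subset\mathbb{R}$ with $J\not\subset[-\eta(a,-b),0]$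 if $a<0$.
   Context: For $t_1,t_2\in\mathbb{R}$, $\chi_{t_1}^{t_2}(s)=1$ if $t_1\le s\le t_2$, $\chi_{t_1}^{t_2}(s)=-1$ if $t_2\le s<t_1$, and $\chi_{t_1}^{t_2}(s)=0$ otherwise. The range of $\arctan$ is $(-\pi/2,\pi/2)$. *)

theory Defs
  imports "HOL-Analysis.Analysis"
begin

text \<open>The signed indicator \<open>\<chi>\<close> of the paper, with lower index \<open>t1\<close> and upper index \<open>t2\<close>.\<close>

definition chi :: "real \<Rightarrow> real \<Rightarrow> real \<Rightarrow> real" where
  "chi t1 t2 s =
     (if t1 \<le> s \<and> s \<le> t2 then 1
      else if t2 \<le> s \<and> s < t1 then - 1
      else 0)"

text \<open>Green's function of the problem \<open>x'(t) + a x(-t) + b x(t) = h(t)\<close>, \<open>x(t0) = c\<close>,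
  in the case \<open>b\<^sup>2 < a\<^sup>2\<close>.\<close>

definition G :: "real \<Rightarrow> real \<Rightarrow> real \<Rightarrow> real \<Rightarrow> real" where
  "G a b t s =
     (let \<omega> = sqrt (a\<^sup>2 - b\<^sup>2) in
        (cos (\<omega> * (s - t)) + b / \<omega> * sin (\<omega> * (s - t))) * chi 0 t s
        + a / \<omega> * sin (\<omega> * (s + t)) * chi (- t) 0 s)"

text \<open>Meaningful only for \<open>\<beta>\<^sup>2 < \<alpha>\<^sup>2\<close>.\<close>

definition eta :: "real \<Rightarrow> real \<Rightarrow> real" where
  "eta \<alpha> \<beta> =
     (if \<beta> > 0 then 1 / sqrt (\<alpha>\<^sup>2 - \<beta>\<^sup>2) * arctan (sqrt (\<alpha>\<^sup>2 - \<beta>\<^sup>2) / \<beta>)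
      else if \<beta> = 0 then pi / (2 * \<bar>\<alpha>\<bar>)
      else 1 / sqrt (\<alpha>\<^sup>2 - \<beta>\<^sup>2) * (arctan (sqrt (\<alpha>\<^sup>2 - \<beta>\<^sup>2) / \<beta>) + pi))"

definition changes_sign_on :: "(real \<Rightarrow> real \<Rightarrow> real) \<Rightarrow> (real \<times> real) set \<Rightarrow> bool" where
  "changes_sign_on g S \<longleftrightarrow> (\<exists>(t, s) \<in> S. g t s > 0) \<and> (\<exists>(t, s) \<in> S. g t s < 0)"

end

theory Submission
  imports Defs
begin

text \<open>
  Write \<open>\<omega> = sqrt (a\<^sup>2 - b\<^sup>2)\<close>. The number \<open>\<theta> = \<omega> * eta a c\<close> is the solution of
  \<open>\<omega> * cos \<theta> = c * sin \<theta>\<close> in \<open>(0, pi)\<close>, so that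
  \<open>cos (\<omega> * u) - c / \<omega> * sin (\<omega> * u) = sin (\<omega> * (eta a c - u)) / sin \<theta>\<close>, whose first positive
  zero in \<open>u\<close> is \<open>eta a c\<close>. For fixed \<open>t\<close>, the function \<open>G a b t\<close> vanishes outside
  \<open>[-\<bar>t\<bar>, \<bar>t\<bar>]\<close>; on the half of this interval containing \<open>t\<close> it is, up to the sign of \<open>t\<close>,
  such an expression with \<open>c = b\<close> or \<open>c = - b\<close>, on the other half it is a multiple of
  \<open>sin (\<omega> * (s + t))\<close>.
\<close>

section \<open>The phase \<open>\<omega> * eta a c\<close> and the first zero of the trigonometric
  factor\<close>

lemma eta_phase:
  fixes a c \<omega> :: real
  assumes "c\<^sup>2 < a\<^sup>2"
  defines "\<omega> \<equiv> sqrt (a\<^sup>2 - c\<^sup>2)"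
  shows "0 < \<omega> * eta a c" and "\<omega> * eta a c < pi"
    and "\<omega> * cos (\<omega> * eta a c) = c * sin (\<omega> * eta a c)"
proof -
  have w: "\<omega> > 0" using assms by simp
  have cos_arctan_pos: "cos (arctan x) > 0" for x
    using arctan_bounded[of x] by (intro cos_gt_zero_pi) auto
  \<comment> \<open>This is \<open>tan (arctan x) = x\<close> with the nonzero denominators
    cleared.\<close>
  have phase: "\<omega> * cos (arctan (\<omega> / c)) = c * sin (arctan (\<omega> / c))" if "c \<noteq> 0"
    using tan_arctan[of "\<omega> / c"] cos_arctan_pos[of "\<omega> / c"] that
    by (simp add: tan_def divide_simps mult.commute)
  consider "c > 0" | "c = 0" | "c < 0" by linarith
  then have "0 < \<omega> * eta a c \<and> \<omega> * eta a c < pi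
      \<and> \<omega> * cos (\<omega> * eta a c) = c * sin (\<omega> * eta a c)"
  proof cases
    case 1
    then have "\<omega> * eta a c = arctan (\<omega> / c)"
      using w by (simp add: eta_def \<omega>_def)
    then show ?thesis
      using 1 w phase arctan_bounded[of "\<omega> / c"] by (auto simp: zero_less_arctan_iff)
  next
    case 2
    then have "\<omega> * eta a c = pi / 2"
      using w by (simp add: eta_def \<omega>_def)
    then show ?thesis using 2 by (simp only:) simp
  next
    case 3
    \<comment> \<open>Here the arctangent lies in (-pi/2, 0). Adding pi moves it into (pi/2, pi) and
      negates both sine and cosine, so the homogeneous relation survives.\<close>
    then have "\<omega> * eta a c = arctan (\<omega> / c) + pi"
      using w by (simp add: eta_def \<omega>_def)
    moreover have "arctan (\<omega> / c) < 0"
      using 3 w by (simp add: arctan_less_zero_iff divide_pos_neg)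
    ultimately show ?thesis
      using 3 phase arctan_bounded[of "\<omega> / c"] by simp
  qed
  then show "0 < \<omega> * eta a c" and "\<omega> * eta a c < pi"
    and "\<omega> * cos (\<omega> * eta a c) = c * sin (\<omega> * eta a c)" by auto
qed

lemma eta_pos: "c\<^sup>2 < a\<^sup>2 \<Longrightarrow> eta a c > 0"
  using eta_phase(1)[of c a] by (simp add: zero_less_mult_iff)

lemma cos_minus_sin_eq_shifted_sin:
  fixes a c \<omega> u :: real
  assumes "c\<^sup>2 < a\<^sup>2"
  defines "\<omega> \<equiv> sqrt (a\<^sup>2 - c\<^sup>2)"
  shows "cos (\<omega> * u) - c / \<omega> * sin (\<omega> * u) = sin (\<omega> * (eta a c - u)) / sin (\<omega> * eta a c)"
proof -
  have w: "\<omega> > 0" using assms by simp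
  have s: "sin (\<omega> * eta a c) > 0"
    using eta_phase[OF assms(1)] unfolding \<omega>_def by (intro sin_gt_zero)
  \<comment> \<open>With \<open>c / \<omega>\<close> written as the cotangent of the phase, the
    claim is the subtraction formula for sine.\<close>
  have c: "c / \<omega> = cos (\<omega> * eta a c) / sin (\<omega> * eta a c)"
    using eta_phase(3)[OF assms(1)] w s unfolding \<omega>_def[symmetric] by (simp add: field_simps)
  show ?thesis
    unfolding c using s by (simp add: right_diff_distrib sin_diff diff_divide_distrib)
qed

lemma cos_minus_sin_nonneg:
  assumes "c\<^sup>2 < a\<^sup>2" "0 \<le> u" "u \<le> eta a c"
  shows "0 \<le> cos (sqrt (a\<^sup>2 - c\<^sup>2) * u) - c / sqrt (a\<^sup>2 - c\<^sup>2) * sin (sqrt (a\<^sup>2 - c\<^sup>2) * u)"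
proof -
  define \<omega> where "\<omega> = sqrt (a\<^sup>2 - c\<^sup>2)"
  have w: "\<omega> > 0" using assms by (simp add: \<omega>_def)
  have e: "0 < \<omega> * eta a c" "\<omega> * eta a c < pi"
    using eta_phase[OF assms(1)] by (auto simp: \<omega>_def)
  have "\<omega> * (eta a c - u) \<le> \<omega> * eta a c"
    using w assms(2) by simp
  then have "0 \<le> sin (\<omega> * (eta a c - u))"
    using e w assms(3) by (intro sin_ge_zero mult_nonneg_nonneg) linarith+
  then show ?thesis
    using e sin_gt_zero[of "\<omega> * eta a c"]
    unfolding \<omega>_def cos_minus_sin_eq_shifted_sin[OF assms(1)] by simp
qed

lemma cos_minus_sin_neg_beyond_eta:
  assumes "c\<^sup>2 < a\<^sup>2" "eta a c < v"
  obtains u where "0 < u" "u < v"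
    "cos (sqrt (a\<^sup>2 - c\<^sup>2) * u) - c / sqrt (a\<^sup>2 - c\<^sup>2) * sin (sqrt (a\<^sup>2 - c\<^sup>2) * u) < 0"
proof -
  define \<omega> where "\<omega> = sqrt (a\<^sup>2 - c\<^sup>2)"
  have w: "\<omega> > 0" using assms by (simp add: \<omega>_def)
  have e: "0 < \<omega> * eta a c" "\<omega> * eta a c < pi"
    using eta_phase[OF assms(1)] by (auto simp: \<omega>_def)
  \<comment> \<open>Staying less than half a period past the zero \<open>eta a c\<close> keeps the
    shifted sine strictly negative.\<close>
  obtain u where u: "eta a c < u" "u < min v (eta a c + pi / \<omega>)"
    using dense[of "eta a c" "min v (eta a c + pi / \<omega>)"] assms(2) w by auto
  have "\<omega> * (u - eta a c) < pi"
    using u w by (simp add: field_simps)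
  then have "0 < sin (\<omega> * (u - eta a c))"
    using u w by (intro sin_gt_zero) auto
  moreover have "\<omega> * (eta a c - u) = - (\<omega> * (u - eta a c))"
    by (simp add: algebra_simps)
  ultimately have "sin (\<omega> * (eta a c - u)) < 0"
    by simp
  then have "cos (\<omega> * u) - c / \<omega> * sin (\<omega> * u) < 0"
    using e sin_gt_zero[of "\<omega> * eta a c"]
    unfolding \<omega>_def cos_minus_sin_eq_shifted_sin[OF assms(1)] by (simp add: divide_neg_pos)
  moreover have "0 < u" using u eta_pos[OF assms(1)] by simp
  ultimately show ?thesis using that u by (auto simp: \<omega>_def)
qed

lemma exists_sin_pos:
  fixes \<omega> r :: real
  assumes "0 < \<omega>" "0 < r"
  obtains v where "0 < v" "v < r" "0 < sin (\<omega> * v)"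
proof -
  obtain v where v: "0 < v" "v < min r (pi / \<omega>)"
    using dense[of 0 "min r (pi / \<omega>)"] assms by auto
  then have "0 < sin (\<omega> * v)"
    using assms by (intro sin_gt_zero) (auto simp: field_simps)
  then show ?thesis using that v by auto
qed

section \<open>Values of \<open>G\<close> on the pieces of a row\<close>

lemma G_pos_same_side:
  assumes "0 < s" "s \<le> t"
  shows "G a b t s = cos (sqrt (a\<^sup>2 - b\<^sup>2) * (t - s))
    - b / sqrt (a\<^sup>2 - b\<^sup>2) * sin (sqrt (a\<^sup>2 - b\<^sup>2) * (t - s))"
proof -
  have "sqrt (a\<^sup>2 - b\<^sup>2) * (s - t) = - (sqrt (a\<^sup>2 - b\<^sup>2) * (t - s))"
    by (simp add: algebra_simps)
  then show ?thesis using assms unfolding G_def Let_def chi_def by simp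
qed

lemma G_pos_opposite_side:
  assumes "- t \<le> s" "s < 0"
  shows "G a b t s = a / sqrt (a\<^sup>2 - b\<^sup>2) * sin (sqrt (a\<^sup>2 - b\<^sup>2) * (s + t))"
  using assms unfolding G_def Let_def chi_def by simp

text \<open>At \<open>s = 0\<close> both characteristic functions equal 1 when \<open>0 \<le> t\<close>.\<close>

lemma G_pos_origin:
  assumes "0 \<le> t"
  shows "G a b t 0 = cos (sqrt (a\<^sup>2 - b\<^sup>2) * t)
    - b / sqrt (a\<^sup>2 - b\<^sup>2) * sin (sqrt (a\<^sup>2 - b\<^sup>2) * t)
    + a / sqrt (a\<^sup>2 - b\<^sup>2) * sin (sqrt (a\<^sup>2 - b\<^sup>2) * t)"
  using assms unfolding G_def Let_def chi_def by simp

lemma G_neg_same_side: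
  assumes "t \<le> s" "s < 0"
  shows "G a b t s = - (cos (sqrt (a\<^sup>2 - b\<^sup>2) * (s - t))
    + b / sqrt (a\<^sup>2 - b\<^sup>2) * sin (sqrt (a\<^sup>2 - b\<^sup>2) * (s - t)))"
  using assms unfolding G_def Let_def chi_def by simp

text \<open>For negative \<open>t\<close> the point \<open>s = 0\<close> belongs to this piece:
  \<open>chi 0 t\<close> vanishes there, while \<open>chi (- t) 0\<close> equals -1.\<close>

lemma G_neg_opposite_side:
  assumes "0 \<le> s" "s < - t"
  shows "G a b t s = - (a / sqrt (a\<^sup>2 - b\<^sup>2) * sin (sqrt (a\<^sup>2 - b\<^sup>2) * (s + t)))"
  using assms unfolding G_def Let_def chi_def by simp

lemma G_outside: "\<bar>t\<bar> < \<bar>s\<bar> \<Longrightarrow> G a b t s = 0"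
  unfolding G_def Let_def chi_def by auto

text \<open>The -1 branch of \<open>chi\<close> is half-open, so \<open>s = - t\<close> falls
  between the opposite half and the region of \<open>G_outside\<close>.\<close>

lemma G_neg_endpoint: "t < 0 \<Longrightarrow> G a b t (- t) = 0"
  unfolding G_def Let_def chi_def by simp

section \<open>Constant sign on the two strips\<close>

lemma G_nonneg:
  assumes "b\<^sup>2 < a\<^sup>2" "0 < a" "0 \<le> t" "t \<le> eta a b"
  shows "0 \<le> G a b t s"
proof -
  define \<omega> where "\<omega> = sqrt (a\<^sup>2 - b\<^sup>2)"
  have w: "\<omega> > 0" using assms by (simp add: \<omega>_def)
  \<comment> \<open>The phase bound keeps \<open>\<omega> * v\<close> within the first half period
    of sine.\<close>
  have sin_nonneg: "0 \<le> a / \<omega> * sin (\<omega> * v)" if "0 \<le> v" "v \<le> t" for v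
  proof -
    have "\<omega> * v \<le> \<omega> * eta a b"
      using that assms(4) w by simp
    then have "\<omega> * v \<le> pi"
      using eta_phase(2)[OF assms(1)] by (simp add: \<omega>_def)
    then show ?thesis
      using that w assms(2) by (intro mult_nonneg_nonneg sin_ge_zero) auto
  qed
  consider "0 < s" "s \<le> t" | "s = 0" | "- t \<le> s" "s < 0" | "\<bar>t\<bar> < \<bar>s\<bar>"
    using assms by linarith
  then show ?thesis
  proof cases
    case 1
    then show ?thesis
      using cos_minus_sin_nonneg[OF assms(1), of "t - s"] assms by (simp add: G_pos_same_side)
  next
    case 2
    then show ?thesis
      using cos_minus_sin_nonneg[OF assms(1), of t] assms sin_nonneg[of t]
      by (simp add: G_pos_origin \<omega>_def)
  next
    case 3
    then show ?thesis
      using sin_nonneg[of "s + t"] by (simp add: G_pos_opposite_side \<omega>_def)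
  next
    case 4
    then show ?thesis by (simp add: G_outside)
  qed
qed

text \<open>The value \<open>t = 0\<close> is excluded because \<open>G a b 0 0 = 1\<close>.\<close>

lemma G_nonpos:
  assumes "b\<^sup>2 < a\<^sup>2" "a < 0" "- eta a (- b) \<le> t" "t < 0"
  shows "G a b t s \<le> 0"
proof -
  define \<omega> where "\<omega> = sqrt (a\<^sup>2 - b\<^sup>2)"
  have w: "\<omega> > 0" using assms by (simp add: \<omega>_def)
  \<comment> \<open>Taking \<open>c = - b\<close> turns the plus sign in
    \<open>G_neg_same_side\<close> into the minus sign of the shifted-sine form.\<close>
  have b: "(- b)\<^sup>2 < a\<^sup>2" using assms by simp
  consider "t \<le> s" "s < 0" | "0 \<le> s" "s < - t" | "s = - t" | "\<bar>t\<bar> < \<bar>s\<bar>"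
    using assms by linarith
  then show ?thesis
  proof cases
    case 1
    then show ?thesis
      using cos_minus_sin_nonneg[OF b, of "s - t"] assms by (simp add: G_neg_same_side)
  next
    case 2
    have "\<omega> * (- (s + t)) \<le> \<omega> * eta a (- b)"
      using 2 assms w by (intro mult_left_mono) auto
    then have "\<omega> * (- (s + t)) \<le> pi"
      using eta_phase(2)[OF b] by (simp add: \<omega>_def)
    moreover have "0 \<le> \<omega> * (- (s + t))"
      using 2 w by (intro mult_nonneg_nonneg) auto
    ultimately have "0 \<le> sin (\<omega> * (- (s + t)))"
      by (rule sin_ge_zero[rotated])
    then have "sin (\<omega> * (s + t)) \<le> 0"
      unfolding mult_minus_right by simp
    then have "0 \<le> a / \<omega> * sin (\<omega> * (s + t))"
      using assms(2) w by (intro mult_nonpos_nonpos) (auto simp: divide_nonpos_pos)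
    then show ?thesis
      using 2 by (simp add: G_neg_opposite_side \<omega>_def)
  next
    case 3
    then show ?thesis using assms by (simp add: G_neg_endpoint)
  next
    case 4
    then show ?thesis by (simp add: G_outside)
  qed
qed

section \<open>Both signs on each row outside the strips\<close>

lemma G_diagonal: "0 < t \<Longrightarrow> G a b t t = 1" "t < 0 \<Longrightarrow> G a b t t = - 1"
  by (simp_all add: G_pos_same_side G_neg_same_side)

lemma G_pos_opposite_side_sign:
  assumes "b\<^sup>2 < a\<^sup>2" "0 < t"
  obtains s r where "G a b t s = a * r" "0 < r"
proof -
  have w: "sqrt (a\<^sup>2 - b\<^sup>2) > 0" using assms by simp
  obtain v where v: "0 < v" "v < t" "0 < sin (sqrt (a\<^sup>2 - b\<^sup>2) * v)"
    using exists_sin_pos[OF w assms(2)] .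
  show ?thesis
  \<comment> \<open>This choice makes \<open>s + t = v\<close>.\<close>
  proof (rule that[of "v - t" "sin (sqrt (a\<^sup>2 - b\<^sup>2) * v) / sqrt (a\<^sup>2 - b\<^sup>2)"])
    show "0 < sin (sqrt (a\<^sup>2 - b\<^sup>2) * v) / sqrt (a\<^sup>2 - b\<^sup>2)"
      using v(3) w by (rule divide_pos_pos)
  qed (use v in \<open>simp add: G_pos_opposite_side\<close>)
qed

lemma G_neg_opposite_side_sign:
  assumes "b\<^sup>2 < a\<^sup>2" "t < 0"
  obtains s r where "G a b t s = a * r" "0 < r"
proof -
  have w: "sqrt (a\<^sup>2 - b\<^sup>2) > 0" using assms by simp
  obtain v where v: "0 < v" "v < - t" "0 < sin (sqrt (a\<^sup>2 - b\<^sup>2) * v)"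
    using exists_sin_pos[OF w, of "- t"] assms(2) by auto
  show ?thesis
  \<comment> \<open>Now \<open>s + t = - v\<close>; oddness of sine cancels the outer minus
    sign.\<close>
  proof (rule that[of "- t - v" "sin (sqrt (a\<^sup>2 - b\<^sup>2) * v) / sqrt (a\<^sup>2 - b\<^sup>2)"])
    show "0 < sin (sqrt (a\<^sup>2 - b\<^sup>2) * v) / sqrt (a\<^sup>2 - b\<^sup>2)"
      using v(3) w by (rule divide_pos_pos)
  qed (use v in \<open>simp add: G_neg_opposite_side\<close>)
qed

text \<open>The diagonal point carries the sign of \<open>t\<close>. The other sign comes from the
  opposite half when \<open>t < 0\<close>, and from just beyond the first zero on the same half when
  \<open>t\<close> exceeds \<open>eta a b\<close>.\<close>

lemma G_both_signs_of_pos: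
  assumes "b\<^sup>2 < a\<^sup>2" "0 < a" "t \<notin> {0 .. eta a b}"
  shows "\<exists>s. 0 < G a b t s" and "\<exists>s. G a b t s < 0"
proof -
  have "(\<exists>s. 0 < G a b t s) \<and> (\<exists>s. G a b t s < 0)"
  proof (cases "t < 0")
    case True
    obtain s r where "G a b t s = a * r" "0 < r"
      using G_neg_opposite_side_sign[OF assms(1) True] .
    then have "0 < G a b t s" using assms(2) by simp
    moreover have "G a b t t < 0" using G_diagonal(2)[OF True] by simp
    ultimately show ?thesis by blast
  next
    case False
    then have t: "eta a b < t" using assms(3) by auto
    then obtain u where u: "0 < u" "u < t"
      "cos (sqrt (a\<^sup>2 - b\<^sup>2) * u) - b / sqrt (a\<^sup>2 - b\<^sup>2) * sin (sqrt (a\<^sup>2 - b\<^sup>2) * u) < 0"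
      using cos_minus_sin_neg_beyond_eta[OF assms(1)] by blast
    then have "G a b t (t - u) < 0" by (simp add: G_pos_same_side)
    moreover have "0 < G a b t t"
      using t eta_pos[OF assms(1)] by (simp add: G_diagonal)
    ultimately show ?thesis by blast
  qed
  then show "\<exists>s. 0 < G a b t s" and "\<exists>s. G a b t s < 0" by auto
qed

lemma G_both_signs_of_neg:
  assumes "b\<^sup>2 < a\<^sup>2" "a < 0" "t \<notin> {- eta a (- b) .. 0}"
  shows "\<exists>s. 0 < G a b t s" and "\<exists>s. G a b t s < 0"
proof -
  have b: "(- b)\<^sup>2 < a\<^sup>2" using assms by simp
  have "(\<exists>s. 0 < G a b t s) \<and> (\<exists>s. G a b t s < 0)"
  proof (cases "0 < t")
    case True
    obtain s r where "G a b t s = a * r" "0 < r"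
      using G_pos_opposite_side_sign[OF assms(1) True] .
    then have "G a b t s < 0" using assms(2) by (simp add: mult_neg_pos)
    moreover have "0 < G a b t t" using G_diagonal(1)[OF True] by simp
    ultimately show ?thesis by blast
  next
    case False
    then have t: "eta a (- b) < - t" using assms(3) by auto
    then obtain u where u: "0 < u" "u < - t"
      "cos (sqrt (a\<^sup>2 - b\<^sup>2) * u) + b / sqrt (a\<^sup>2 - b\<^sup>2) * sin (sqrt (a\<^sup>2 - b\<^sup>2) * u) < 0"
      using cos_minus_sin_neg_beyond_eta[OF b] by auto
    then have "0 < G a b t (t + u)" by (simp add: G_neg_same_side)
    moreover have "G a b t t < 0"
      using t eta_pos[OF b] by (simp add: G_diagonal)
    ultimately show ?thesis by blast
  qed
  then show "\<exists>s. 0 < G a b t s" and "\<exists>s. G a b t s < 0" by auto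
qed

lemma changes_sign_on_strip:
  assumes "t \<in> J" "\<exists>s. 0 < g t s" "\<exists>s. g t s < 0"
  shows "changes_sign_on g (J \<times> UNIV)"
  using assms unfolding changes_sign_on_def by auto

theorem mainTheorem7:
  fixes a b :: real
  assumes "a\<^sup>2 > b\<^sup>2"
  shows "(a > 0 \<longrightarrow> (\<forall>t \<in> {0 .. eta a b}. AE s in lebesgue. G a b t s \<ge> 0))
    \<and> (a < 0 \<longrightarrow> (\<forall>t \<in> {- eta a (- b) .. 0}. AE s in lebesgue. G a b t s \<le> 0))
    \<and> (a > 0 \<longrightarrow> (\<forall>J :: real set. is_interval J \<and> \<not> J \<subseteq> {0 .. eta a b} \<longrightarrow>
          changes_sign_on (G a b) (J \<times> UNIV)))
    \<and> (a < 0 \<longrightarrow> (\<forall>J :: real set. is_interval J \<and> \<not> J \<subseteq> {- eta a (- b) .. 0} \<longrightarrow>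
          changes_sign_on (G a b) (J \<times> UNIV)))"
proof (intro conjI impI ballI allI)
  fix t assume "0 < a" "t \<in> {0 .. eta a b}"
  then show "AE s in lebesgue. G a b t s \<ge> 0"
    using G_nonneg[OF assms] by simp
next
  fix t assume *: "a < 0" "t \<in> {- eta a (- b) .. 0}"
  show "AE s in lebesgue. G a b t s \<le> 0"
  proof (cases "t = 0")
    case True
    \<comment> \<open>The row \<open>t = 0\<close> is zero except at the origin, where it is 1; that
      point is a null set.\<close>
    have "AE s in lebesgue. s \<noteq> (0 :: real)"
      by (intro AE_completion AE_lborel_singleton)
    then show ?thesis
      using True by (auto simp: G_outside elim: eventually_mono)
  next
    case False
    then show ?thesis
      using * G_nonpos[OF assms] by simp
  qed
next
  fix J :: "real set"
  assume "0 < a" and J: "is_interval J \<and> \<not> J \<subseteq> {0 .. eta a b}"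
  \<comment> \<open>The single row over such a \<open>t\<close> already shows both signs.\<close>
  moreover obtain t where "t \<in> J" "t \<notin> {0 .. eta a b}" using J by blast
  ultimately show "changes_sign_on (G a b) (J \<times> UNIV)"
    using G_both_signs_of_pos[OF assms] changes_sign_on_strip by blast
next
  fix J :: "real set"
  assume "a < 0" and J: "is_interval J \<and> \<not> J \<subseteq> {- eta a (- b) .. 0}"
  moreover obtain t where "t \<in> J" "t \<notin> {- eta a (- b) .. 0}" using J by blast
  ultimately show "changes_sign_on (G a b) (J \<times> UNIV)"
    using G_both_signs_of_neg[OF assms] changes_sign_on_strip by blast
qed

end
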